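(* Let $C_w,C_k,C_\sigma,C_a,\rho,R_u,\widetilde\gamma,\hat d>0$, $\delta>\log 2$ and $M\in\mathbb N$ be fixed, let $L,n\ge1$ be integers, and let $\widehat{\mathcal L}_S(\mathcal G)\ge0$ be the empirical risk. Let $X_0,\dots,X_L$ be independent Bernoulli random variables with $\mathbb P\{X_j=1\}=p_j$, $\mathbb P\{X_j=0\}=1-p_j$, and assume $p_j=x_j/L^{\frac1{\hat d+1}}$ where $x_j\in[0,1]$ satisfy $\sum_{j=0}^\infty x_j<\infty$. Put $Z_j=1$ for all $j$ and $$\mathrm{RHS}:=\widehat{\mathcal L}_S(\mathcal G)+2\widetilde\gamma L^{\frac1{\hat d+1}}\left(\sum_{j=0}^{L}\frac{X_jC_w^{M+1}C_\sigma^M}{Z_j+X_jC_w^{M+1}C_\sigma^M}+\frac{X_j}{Z_j+X_jC_kC_\sigma}\right)\left[\prod_{j=0}^{L}(Z_j+X_jC_w^{M+1}C_\sigma^M)(Z_j+X_jC_kC_\sigma)\right]\left(\frac1n\right)^{\frac1{\hat d+1}}$$ $$\qquad+\left(\rho\left[\prod_{j=0}^{L}(Z_j+X_jC_w^{M+1}C_\sigma^M)(Z_j+X_jC_kC_\sigma)\right]C_a+R_u\right)\sqrt{\frac{2\delta}{n}}.$$ Then the expectation with respect to $(X_0,\dots,X_L)$ satisfies $$\mathbb E[\mathrm{RHS}]\lesssim\widehat{\mathcal L}_S(\mathcal G)+\left(\sum_{j=0}^{L}x_j\right)\prod_{j=0}^{L}\left[1+\kappa\,x_j\right]\left(\frac1n\right)^{\frac1{\hat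 d+1}}+\left(\rho\prod_{j=0}^{L}\left[1+\kappa\,x_j\right]C_a+R_u\right)\sqrt{\frac{2\delta}{n}},$$ where $\kappa:=C_w^{M+1}C_\sigma^M+C_kC_\sigma+C_w^{M+1}C_kC_\sigma^{M+1}$, and $\lesssim$ means that the left-hand side is bounded above by the right-hand side times a constant independent of $n$ and $L$.
   Context: $\mathrm{RHS}$ is the right-hand side of a generalization error bound for sequential neural operators with stochastic depth (layer $j$ is kept iff $X_j=1$); $\hat d$ is the doubling dimension of $D\times D$ for the spatial domain $D$, and $\widetilde\gamma$ is a positive constant independent of $L$ and $n$. The term $\widehat{\mathcal L}_S(\mathcal G)$ is treated as fixed (not random) when taking the expectation over $X_0,\dots,X_L$. *)

theory Defs
  imports "HOL-Probability.Probability"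
begin

text \<open>Independent random variables \<open>X j\<close>, \<open>j \<in> I\<close>, with values \<open>1\<close> and \<open>0\<close> taken with
  probabilities \<open>p j\<close> and \<open>1 - p j\<close>; other real values are possible only on a null set.\<close>

definition indep_bernoulli ::
    "'w measure \<Rightarrow> nat set \<Rightarrow> (nat \<Rightarrow> real) \<Rightarrow> (nat \<Rightarrow> 'w \<Rightarrow> real) \<Rightarrow> bool" where
  "indep_bernoulli P I p X \<longleftrightarrow>
     prob_space P \<and>
     prob_space.indep_vars P (\<lambda>_. borel) X I \<and>
     (\<forall>j\<in>I. measure P {w \<in> space P. X j w = 1} = p j \<and>
            measure P {w \<in> space P. X j w = 0} = 1 - p j)"

text \<open>The right-hand side of the generalization bound for the layer indicators \<open>X j\<close> (and skip
  coefficients \<open>Z j\<close>). The argument \<open>d\<close> is the doubling dimension of \<open>D \<times> D\<close>, and \<open>risk\<close> is the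
  empirical risk.\<close>

definition gen_bound ::
    "real \<Rightarrow> real \<Rightarrow> real \<Rightarrow> real \<Rightarrow> real \<Rightarrow> real \<Rightarrow> real \<Rightarrow> real \<Rightarrow> real \<Rightarrow> nat \<Rightarrow>
     nat \<Rightarrow> nat \<Rightarrow> real \<Rightarrow> (nat \<Rightarrow> real) \<Rightarrow> (nat \<Rightarrow> real) \<Rightarrow> real" where
  "gen_bound Cw Ck C\<sigma> Ca \<rho> Ru \<gamma> d \<delta> M L n risk Z X =
     risk
     + 2 * \<gamma> * real L powr (1 / (d + 1))
         * (\<Sum>j=0..L. X j * Cw ^ (M + 1) * C\<sigma> ^ M / (Z j + X j * Cw ^ (M + 1) * C\<sigma> ^ M)
                     + X j / (Z j + X j * Ck * C\<sigma>))
         * (\<Prod>j=0..L. (Z j + X j * Cw ^ (M + 1) * C\<sigma> ^ M) * (Z j + X j * Ck * C\<sigma>))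
         * (1 / real n) powr (1 / (d + 1))
     + (\<rho> * (\<Prod>j=0..L. (Z j + X j * Cw ^ (M + 1) * C\<sigma> ^ M) * (Z j + X j * Ck * C\<sigma>)) * Ca + Ru)
         * sqrt (2 * \<delta> / real n)"

definition kappa :: "real \<Rightarrow> real \<Rightarrow> real \<Rightarrow> nat \<Rightarrow> real" where
  "kappa Cw Ck C\<sigma> M = Cw ^ (M + 1) * C\<sigma> ^ M + Ck * C\<sigma> + Cw ^ (M + 1) * Ck * C\<sigma> ^ (M + 1)"

definition mean_bound ::
    "real \<Rightarrow> real \<Rightarrow> real \<Rightarrow> real \<Rightarrow> real \<Rightarrow> real \<Rightarrow> real \<Rightarrow> real \<Rightarrow> nat \<Rightarrow>
     nat \<Rightarrow> nat \<Rightarrow> real \<Rightarrow> (nat \<Rightarrow> real) \<Rightarrow> real" where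
  "mean_bound Cw Ck C\<sigma> Ca \<rho> Ru d \<delta> M L n risk x =
     risk
     + (\<Sum>j=0..L. x j) * (\<Prod>j=0..L. 1 + kappa Cw Ck C\<sigma> M * x j) * (1 / real n) powr (1 / (d + 1))
     + (\<rho> * (\<Prod>j=0..L. 1 + kappa Cw Ck C\<sigma> M * x j) * Ca + Ru) * sqrt (2 * \<delta> / real n)"

end

theory Submission
  imports Defs
begin

text \<open>Almost surely every \<open>X j\<close> is \<open>0\<close> or \<open>1\<close>. Hence each factor of the product in the bound equals
  \<open>1 + \<kappa> * X j\<close>, and the \<open>j\<close>-th summand times that product is a constant times \<open>X j\<close> times the
  product over the layers \<open>i \<noteq> j\<close>. By independence, expectations of products of affine functions of
  the \<open>X j\<close> are obtained by substituting \<open>p j\<close> for \<open>X j\<close>. The factor \<open>L powr (1 / (d + 1))\<close> in the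
  bound cancels the denominator of \<open>p j\<close>, and \<open>p i \<le> x i\<close> in the remaining product.\<close>

lemma indep_bernoulli_AE:
  assumes "indep_bernoulli P I p X" "j \<in> I"
  shows "AE w in P. X j w = 0 \<or> X j w = 1"
proof -
  interpret prob_space P
    using assms by (simp add: indep_bernoulli_def)
  have [measurable]: "X j \<in> borel_measurable P"
    using assms by (auto simp: indep_bernoulli_def indep_vars_def)
  \<comment> \<open>The two events are disjoint and their probabilities \<open>1 - p j\<close> and
    \<open>p j\<close> add up to 1.\<close>
  have "prob {w \<in> space P. X j w = 0 \<or> X j w = 1}
      = prob ({w \<in> space P. X j w = 0} \<union> {w \<in> space P. X j w = 1})"
    by (rule arg_cong[where f = prob]) auto
  also have "\<dots> = prob {w \<in> space P. X j w = 0} + prob {w \<in> space P. X j w = 1}"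
    by (rule finite_measure_Union) auto
  also have "\<dots> = 1"
    using assms by (simp add: indep_bernoulli_def)
  finally show ?thesis
    by (subst (asm) prob_Collect_eq_1) auto
qed

lemma indep_bernoulli_expectation:
  assumes "indep_bernoulli P I p X" "j \<in> I"
  shows "has_bochner_integral P (X j) (p j)"
proof -
  interpret prob_space P
    using assms by (simp add: indep_bernoulli_def)
  have [measurable]: "X j \<in> borel_measurable P"
    using assms by (auto simp: indep_bernoulli_def indep_vars_def)
  have "has_bochner_integral P (indicator {w \<in> space P. X j w = 1}) (prob {w \<in> space P. X j w = 1})"
    by (rule has_bochner_integral_real_indicator) (auto simp: emeasure_eq_measure)
  \<comment> \<open>Off the null set where \<open>X j\<close> is neither 0 nor 1, it is the
    indicator of the event \<open>X j = 1\<close>, so its mean is the probability of that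
    event.\<close>
  moreover have "AE w in P. indicator {w \<in> space P. X j w = 1} w = X j w"
    using indep_bernoulli_AE[OF assms] AE_space by eventually_elim (auto simp: indicator_def)
  ultimately have "has_bochner_integral P (X j) (prob {w \<in> space P. X j w = 1})"
    by (subst (asm) has_bochner_integral_cong_AE) auto
  thus ?thesis
    using assms by (simp add: indep_bernoulli_def)
qed

text \<open>Affine images of independent variables are independent, so the mean of the product
  factorises. Letting \<open>a\<close> and \<open>b\<close> vary with the index covers both a factor
  \<open>1 + \<kappa> * X i\<close> and a bare factor \<open>X j\<close> (coefficients 0 and
  1).\<close>

lemma indep_bernoulli_expectation_prod_affine:
  assumes "indep_bernoulli P I p X" "finite I"
  shows "has_bochner_integral P (\<lambda>w. \<Prod>j\<in>I. a j + b j * X j w) (\<Prod>j\<in>I. a j + b j * p j)"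
proof -
  interpret prob_space P
    using assms by (simp add: indep_bernoulli_def)
  have "indep_vars (\<lambda>_. borel) X I"
    using assms by (simp add: indep_bernoulli_def)
  hence indep: "indep_vars (\<lambda>_. borel) (\<lambda>j w. a j + b j * X j w) I"
    by (rule indep_vars_compose2) auto
  have affine: "has_bochner_integral P (\<lambda>w. a j + b j * X j w) (a j + b j * p j)" if "j \<in> I" for j
  proof -
    have "has_bochner_integral P (\<lambda>w. a j) (a j)"
      by (simp add: has_bochner_integral_iff prob_space)
    from has_bochner_integral_add[OF this
        has_bochner_integral_mult_right[OF indep_bernoulli_expectation[OF assms(1) that], of "b j"]]
    show ?thesis by simp
  qed
  have "integrable P (\<lambda>w. \<Prod>j\<in>I. a j + b j * X j w)"
    using affine by (intro indep_vars_integrable[OF assms(2) indep]) (auto simp: has_bochner_integral_iff)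
  moreover have "(\<integral>w. (\<Prod>j\<in>I. a j + b j * X j w) \<partial>P) = (\<Prod>j\<in>I. a j + b j * p j)"
    using affine
    by (subst indep_vars_lebesgue_integral[OF assms(2) indep]) (auto simp: has_bochner_integral_iff)
  ultimately show ?thesis
    by (simp add: has_bochner_integral_iff)
qed

text \<open>Clears the random denominators: on 0-1 values the bound is a polynomial of degree at
  most one in each \<open>y i\<close>. The case distinctions write \<open>y j\<close> times the
  product over the other layers as a single product of affine factors, the form whose expectation is
  known.\<close>

lemma gen_bound_zero_one:
  fixes Cw Ck C\<sigma> :: real and y :: "nat \<Rightarrow> real" and M :: nat
  defines "a \<equiv> Cw ^ (M + 1) * C\<sigma> ^ M" and "b \<equiv> Ck * C\<sigma>" and "\<kappa> \<equiv> kappa Cw Ck C\<sigma> M"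
  assumes y: "\<And>j. j \<in> {0..L} \<Longrightarrow> y j = 0 \<or> y j = 1"
  shows "gen_bound Cw Ck C\<sigma> Ca \<rho> Ru \<gamma> d \<delta> M L n risk (\<lambda>_. 1) y
       = risk + (\<Sum>j=0..L. 2 * \<gamma> * real L powr (1 / (d + 1)) * ((a / (1 + a) + 1 / (1 + b)) * (1 + \<kappa>))
             * (1 / real n) powr (1 / (d + 1))
             * (\<Prod>i=0..L. (if i = j then 0 else 1) + (if i = j then 1 else \<kappa>) * y i))
         + (\<rho> * Ca * sqrt (2 * \<delta> / real n) * (\<Prod>j=0..L. 1 + \<kappa> * y j) + Ru * sqrt (2 * \<delta> / real n))"
proof -
  have \<kappa>: "\<kappa> = a + b + a * b"
    by (simp add: \<kappa>_def kappa_def a_def b_def)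
  have prod: "(\<Prod>j=0..L. (1 + y j * Cw ^ (M + 1) * C\<sigma> ^ M) * (1 + y j * Ck * C\<sigma>))
            = (\<Prod>j=0..L. 1 + \<kappa> * y j)"
  \<comment> \<open>Expanding a factor gives \<open>1 + (a + b) * y j + a * b * (y j)^2\<close>, and
    \<open>(y j)^2 = y j\<close> on 0-1 values.\<close>
  proof (rule prod.cong)
    fix j assume "j \<in> {0..L}"
    from y[OF this] show "(1 + y j * Cw ^ (M + 1) * C\<sigma> ^ M) * (1 + y j * Ck * C\<sigma>) = 1 + \<kappa> * y j"
      unfolding \<kappa> by (auto simp: a_def b_def algebra_simps)
  qed simp
  have summand: "(y j * Cw ^ (M + 1) * C\<sigma> ^ M / (1 + y j * Cw ^ (M + 1) * C\<sigma> ^ M)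
                  + y j / (1 + y j * Ck * C\<sigma>)) * (\<Prod>i=0..L. 1 + \<kappa> * y i)
        = (a / (1 + a) + 1 / (1 + b)) * (1 + \<kappa>)
           * (\<Prod>i=0..L. (if i = j then 0 else 1) + (if i = j then 1 else \<kappa>) * y i)"
    if j: "j \<in> {0..L}" for j
  proof -
    have "(\<Prod>i\<in>{0..L}-{j}. (if i = j then 0 else 1) + (if i = j then 1 else \<kappa>) * y i)
        = (\<Prod>i\<in>{0..L}-{j}. 1 + \<kappa> * y i)"
      by (rule prod.cong) auto
    \<comment> \<open>If \<open>y j = 0\<close>, both sides vanish. If \<open>y j = 1\<close>, the
      quotients become \<open>a / (1 + a)\<close> and \<open>1 / (1 + b)\<close>, and layer
      \<open>j\<close> contributes \<open>1 + \<kappa>\<close> to the product.\<close>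
    thus ?thesis
      using y[OF j] j by (auto simp: prod.remove[of "{0..L}" j] a_def b_def algebra_simps add_divide_distrib)
  qed
  have "(\<Sum>j=0..L. y j * Cw ^ (M + 1) * C\<sigma> ^ M / (1 + y j * Cw ^ (M + 1) * C\<sigma> ^ M)
                  + y j / (1 + y j * Ck * C\<sigma>)) * (\<Prod>i=0..L. 1 + \<kappa> * y i)
      = (\<Sum>j=0..L. (a / (1 + a) + 1 / (1 + b)) * (1 + \<kappa>)
           * (\<Prod>i=0..L. (if i = j then 0 else 1) + (if i = j then 1 else \<kappa>) * y i))"
    unfolding sum_distrib_right by (rule sum.cong) (simp, rule summand)
  hence "2 * \<gamma> * real L powr (1 / (d + 1))
      * (\<Sum>j=0..L. y j * Cw ^ (M + 1) * C\<sigma> ^ M / (1 + y j * Cw ^ (M + 1) * C\<sigma> ^ M)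
                  + y j / (1 + y j * Ck * C\<sigma>))
      * (\<Prod>i=0..L. 1 + \<kappa> * y i) * (1 / real n) powr (1 / (d + 1))
     = (\<Sum>j=0..L. 2 * \<gamma> * real L powr (1 / (d + 1)) * ((a / (1 + a) + 1 / (1 + b)) * (1 + \<kappa>))
             * (1 / real n) powr (1 / (d + 1))
             * (\<Prod>i=0..L. (if i = j then 0 else 1) + (if i = j then 1 else \<kappa>) * y i))"
    unfolding sum_distrib_left[symmetric] by (simp only: mult.assoc) (simp only: ac_simps)
  thus ?thesis
    unfolding gen_bound_def prod by (simp add: algebra_simps)
qed

lemma expectation_gen_bound:
  fixes Cw Ck C\<sigma> :: real and p :: "nat \<Rightarrow> real" and M :: nat
  defines "a \<equiv> Cw ^ (M + 1) * C\<sigma> ^ M" and "b \<equiv> Ck * C\<sigma>" and "\<kappa> \<equiv> kappa Cw Ck C\<sigma> M"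
  assumes X: "indep_bernoulli P {0..L} p X"
  shows "(\<integral>w. gen_bound Cw Ck C\<sigma> Ca \<rho> Ru \<gamma> d \<delta> M L n risk (\<lambda>_. 1) (\<lambda>j. X j w) \<partial>P)
       = risk + (\<Sum>j=0..L. 2 * \<gamma> * real L powr (1 / (d + 1)) * ((a / (1 + a) + 1 / (1 + b)) * (1 + \<kappa>))
             * (1 / real n) powr (1 / (d + 1))
             * (\<Prod>i=0..L. (if i = j then 0 else 1) + (if i = j then 1 else \<kappa>) * p i))
         + (\<rho> * Ca * sqrt (2 * \<delta> / real n) * (\<Prod>j=0..L. 1 + \<kappa> * p j) + Ru * sqrt (2 * \<delta> / real n))"
    (is "_ = ?E")
proof -
  interpret prob_space P
    using X by (simp add: indep_bernoulli_def)
  have X_meas: "X j \<in> borel_measurable P" if "j \<in> {0..L}" for j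
    using X that by (auto simp: indep_bernoulli_def indep_vars_def)
  let ?F = "\<lambda>y. risk + (\<Sum>j=0..L. 2 * \<gamma> * real L powr (1 / (d + 1))
             * ((a / (1 + a) + 1 / (1 + b)) * (1 + \<kappa>)) * (1 / real n) powr (1 / (d + 1))
             * (\<Prod>i=0..L. (if i = j then 0 else 1) + (if i = j then 1 else \<kappa>) * y i))
         + (\<rho> * Ca * sqrt (2 * \<delta> / real n) * (\<Prod>j=0..L. 1 + \<kappa> * y j) + Ru * sqrt (2 * \<delta> / real n))"
  have const: "has_bochner_integral P (\<lambda>_. c) c" for c :: real
    by (simp add: has_bochner_integral_iff prob_space)
  \<comment> \<open>\<open>?E\<close> is \<open>?F\<close> evaluated at \<open>p\<close>. Linearity
    reduces the claim to the products of affine factors, and integrability comes along with the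
    value.\<close>
  have F: "has_bochner_integral P (\<lambda>w. ?F (\<lambda>j. X j w)) ?E"
    by (intro has_bochner_integral_add const has_bochner_integral_sum has_bochner_integral_mult_right
        indep_bernoulli_expectation_prod_affine[OF X] finite_atLeastAtMost)
  have "AE w in P. \<forall>j\<in>{0..L}. X j w = 0 \<or> X j w = 1"
    using indep_bernoulli_AE[OF X] by (intro AE_finite_allI) auto
  hence AE: "AE w in P. gen_bound Cw Ck C\<sigma> Ca \<rho> Ru \<gamma> d \<delta> M L n risk (\<lambda>_. 1) (\<lambda>j. X j w)
             = ?F (\<lambda>j. X j w)"
    unfolding a_def b_def \<kappa>_def by eventually_elim (rule gen_bound_zero_one, blast)
  \<comment> \<open>The bound agrees with \<open>?F\<close> only almost everywhere, so its
    measurability is shown separately before the integrals are identified.\<close>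
  have meas: "(\<lambda>w. gen_bound Cw Ck C\<sigma> Ca \<rho> Ru \<gamma> d \<delta> M L n risk (\<lambda>_. 1) (\<lambda>j. X j w))
      \<in> borel_measurable P"
    unfolding gen_bound_def
    by (intro borel_measurable_add borel_measurable_times borel_measurable_sum borel_measurable_prod
        borel_measurable_divide borel_measurable_const X_meas)
  show ?thesis
    by (rule trans[OF integral_cong_AE[OF meas borel_measurable_has_bochner_integral[OF F] AE]
          has_bochner_integral_integral_eq[OF F]])
qed

theorem lemmaC1:
  fixes Cw Ck C\<sigma> Ca \<rho> Ru \<gamma> d \<delta> :: real and M :: nat
  assumes "Cw > 0" "Ck > 0" "C\<sigma> > 0" "Ca > 0" "\<rho> > 0" "Ru > 0" "\<gamma> > 0" "d > 0"
    and "\<delta> > ln 2"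
  shows "\<exists>C>0. \<forall>(L::nat) (n::nat) (risk::real) (x::nat \<Rightarrow> real)
            (P::'w measure) (X::nat \<Rightarrow> 'w \<Rightarrow> real).
          L \<ge> 1 \<longrightarrow> n \<ge> 1 \<longrightarrow> risk \<ge> 0 \<longrightarrow>
          (\<forall>j. x j \<in> {0..1}) \<longrightarrow> summable x \<longrightarrow>
          indep_bernoulli P {0..L} (\<lambda>j. x j / real L powr (1 / (d + 1))) X \<longrightarrow>
          (\<integral>w. gen_bound Cw Ck C\<sigma> Ca \<rho> Ru \<gamma> d \<delta> M L n risk (\<lambda>_. 1) (\<lambda>j. X j w) \<partial>P)
            \<le> C * mean_bound Cw Ck C\<sigma> Ca \<rho> Ru d \<delta> M L n risk x"
proof -
  define a where "a = Cw ^ (M + 1) * C\<sigma> ^ M"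
  define b where "b = Ck * C\<sigma>"
  define \<kappa> where "\<kappa> = kappa Cw Ck C\<sigma> M"
  define K where "K = (a / (1 + a) + 1 / (1 + b)) * (1 + \<kappa>)"
  \<comment> \<open>The entry \<open>2 * \<gamma> * K\<close> serves the sum over layers; the entry
    1 serves the empirical risk and the last term. Only the fixed parameters enter, so
    \<open>C\<close> is uniform in \<open>L\<close> and \<open>n\<close>.\<close>
  define C where "C = max 1 (2 * \<gamma> * K)"
  have "a > 0" "b > 0" "\<kappa> > 0"
    using assms by (auto simp: a_def b_def \<kappa>_def kappa_def intro!: add_pos_pos)
  hence K: "K > 0"
    by (auto simp: K_def intro!: mult_pos_pos add_pos_pos)
  have C: "C \<ge> 1" "2 * \<gamma> * K \<le> C"
    by (auto simp: C_def)
  have "\<delta> > 0"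
    using assms(9) ln_gt_zero[of 2] by linarith
  show ?thesis
  proof (intro exI[of _ C] conjI allI impI)
    fix L n :: nat and risk :: real and x :: "nat \<Rightarrow> real" and P :: "'w measure"
      and X :: "nat \<Rightarrow> 'w \<Rightarrow> real"
    assume L: "L \<ge> 1" and "risk \<ge> 0" and x: "\<forall>j. x j \<in> {0..1}"
      and X: "indep_bernoulli P {0..L} (\<lambda>j. x j / real L powr (1 / (d + 1))) X"
    define s where "s = real L powr (1 / (d + 1))"
    define t where "t = (1 / real n) powr (1 / (d + 1))"
    define r where "r = sqrt (2 * \<delta> / real n)"
    define Q where "Q = (\<Prod>j=0..L. 1 + \<kappa> * x j)"
    \<comment> \<open>This makes the success probability \<open>x j / s\<close> at most
      \<open>x j\<close>.\<close>
    have s: "s \<ge> 1"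
      using L assms unfolding s_def by (intro ge_one_powr_ge_zero) auto
    have nonneg: "t \<ge> 0" "r \<ge> 0" "\<And>j. x j \<ge> 0" "Q \<ge> 0"
      using x \<open>\<delta> > 0\<close> \<open>\<kappa> > 0\<close> by (auto simp: t_def r_def Q_def intro!: prod_nonneg)
    have p: "0 \<le> x j / s" "x j / s \<le> x j" for j
      using nonneg(3)[of j] s by (auto simp: divide_le_eq mult_le_cancel_left1)
    have factor: "1 \<le> 1 + \<kappa> * x j" "0 \<le> 1 + \<kappa> * (x j / s)"
      "1 + \<kappa> * (x j / s) \<le> 1 + \<kappa> * x j" for j
      using mult_nonneg_nonneg[of \<kappa> "x j"] mult_nonneg_nonneg[of \<kappa> "x j / s"]
        mult_left_mono[of "x j / s" "x j" \<kappa>] p[of j] nonneg(3)[of j] \<open>\<kappa> > 0\<close>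
      by linarith+
    have Q: "(\<Prod>j=0..L. 1 + \<kappa> * (x j / s)) \<le> Q"
      unfolding Q_def by (rule prod_mono) (use factor in auto)
    have summand: "2 * \<gamma> * s * K * t
            * (\<Prod>i=0..L. (if i = j then 0 else 1) + (if i = j then 1 else \<kappa>) * (x i / s))
          \<le> C * (x j * Q * t)" if j: "j \<in> {0..L}" for j
    proof -
      have "(\<Prod>i=0..L. (if i = j then 0 else 1) + (if i = j then 1 else \<kappa>) * (x i / s))
          = x j / s * (\<Prod>i\<in>{0..L}-{j}. 1 + \<kappa> * (x i / s))"
        using j by (subst prod.remove[of _ j]) (auto intro!: prod.cong)
      also have "\<dots> \<le> x j / s * (\<Prod>i\<in>{0..L}-{j}. 1 + \<kappa> * x i)"
        using p factor by (intro mult_left_mono prod_mono) auto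
      \<comment> \<open>The missing factor \<open>1 + \<kappa> * x j\<close> is at least 1, so
        restoring it only enlarges the product.\<close>
      also have "\<dots> \<le> x j / s * Q"
        unfolding Q_def using p factor
        by (intro mult_left_mono prod_mono2) (auto intro: order.trans[OF zero_le_one])
      finally have "2 * \<gamma> * s * K * t
            * (\<Prod>i=0..L. (if i = j then 0 else 1) + (if i = j then 1 else \<kappa>) * (x i / s))
          \<le> 2 * \<gamma> * s * K * t * (x j / s * Q)"
        using assms s K nonneg by (intro mult_left_mono) auto
      \<comment> \<open>The depth factor \<open>s\<close> of the bound cancels the
        \<open>1 / s\<close> from the success probability of layer \<open>j\<close>, removing the
        explicit power of \<open>L\<close>.\<close>
      also have "\<dots> = 2 * \<gamma> * K * (x j * Q * t)"
        using s by (simp add: field_simps)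
      also have "\<dots> \<le> C * (x j * Q * t)"
        using C nonneg by (intro mult_right_mono) auto
      finally show ?thesis .
    qed
    have "(\<integral>w. gen_bound Cw Ck C\<sigma> Ca \<rho> Ru \<gamma> d \<delta> M L n risk (\<lambda>_. 1) (\<lambda>j. X j w) \<partial>P)
       = risk + (\<Sum>j=0..L. 2 * \<gamma> * s * K * t
             * (\<Prod>i=0..L. (if i = j then 0 else 1) + (if i = j then 1 else \<kappa>) * (x i / s)))
         + (\<rho> * Ca * r * (\<Prod>j=0..L. 1 + \<kappa> * (x j / s)) + Ru * r)"
      unfolding expectation_gen_bound[OF X] s_def t_def r_def K_def a_def b_def \<kappa>_def ..
    also have "\<dots> \<le> risk + (\<Sum>j=0..L. C * (x j * Q * t)) + (\<rho> * Ca * r * Q + Ru * r)"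
      using assms nonneg Q by (intro add_mono sum_mono summand mult_left_mono) auto
    \<comment> \<open>The risk and the last term are nonnegative, so multiplying them by
      \<open>C \<ge> 1\<close> only increases them.\<close>
    also have "\<dots> \<le> C * risk + (\<Sum>j=0..L. C * (x j * Q * t)) + C * (\<rho> * Ca * r * Q + Ru * r)"
      using mult_right_mono[OF C(1), of risk] mult_right_mono[OF C(1), of "\<rho> * Ca * r * Q + Ru * r"]
        assms nonneg \<open>risk \<ge> 0\<close> by auto
    also have "\<dots> = C * mean_bound Cw Ck C\<sigma> Ca \<rho> Ru d \<delta> M L n risk x"
      unfolding mean_bound_def \<kappa>_def[symmetric] Q_def[symmetric] t_def[symmetric] r_def[symmetric]
      by (simp add: algebra_simps sum_distrib_left sum_distrib_right)
    finally show "(\<integral>w. gen_bound Cw Ck C\<sigma> Ca \<rho> Ru \<gamma> d \<delta> M L n risk (\<lambda>_. 1) (\<lambda>j. X j w) \<partial>P)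
            \<le> C * mean_bound Cw Ck C\<sigma> Ca \<rho> Ru d \<delta> M L n risk x" .
  qed (use C in auto)
qed

end
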